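(* Let $n\ge2$, $0<s<1$, and let $\Omega$ be a bounded domain in $\mathbb{H}^n$. Assume that $u\in\mathcal{L}_s(\mathbb{H}^n)\cap C^{1,1}_{loc}(\Omega)$ and that $u$ is lower semi-continuous on $\bar\Omega$. If $$(-\Delta_{\mathbb{H}^n})^su\ge0\ \text{ in }\Omega,\qquad u\ge0\ \text{ in }\mathbb{H}^n\setminus\Omega,$$ then $u\ge0$ in $\Omega$. If moreover $u=0$ at some point in $\Omega$, then $u(x)=0$ for almost every $x\in\mathbb{H}^n$.
   Context: $\mathbb{H}^n$ is the $n$-dimensional hyperbolic space of constant sectional curvature $-1$, with geodesic distance $d$, Riemannian volume element $d\xi$, and a fixed base point $o$. The fractional Laplacian is defined pointwise by $$(-\Delta_{\mathbb{H}^n})^su(x)=C_{n,s}\,\mathrm{P.V.}\int_{\mathbb{H}^n}(u(x)-u(\xi))\,\mathcal{K}_{n,s}(d(x,\xi))\,d\xi ,$$ where $C_{n,s}>0$ is a normalization constant and the positive kernel $\mathcal{K}_{n,s}$ is, up to a positive multiplicative constant, $$\mathcal{K}_{n,s}(\rho)=\left(-\frac{\partial_\rho}{\sinh\rho}\right)^{\frac{n-1}{2}}\left(\rho^{-\frac{1+2s}{2}}K_{\frac{1+2s}{2}}\left(\tfrac{n-1}{2}\rho\right)\right)\quad(n\ge3\text{ odd}),$$ $$\mathcal{K}_{n,s}(\rho)=\int_\rho^\infty\frac{\sinh r}{\sqrt{\cosh r-\cosh\rho}}\left(-\frac{\partial_r}{\sinh r}\right)^{\frac n2}\left(r^{-\frac{1+2s}{2}}K_{\frac{1+2s}{2}}\left(\tfrac{n-1}{2}r\right)\right)dr\quad(n\ge2\text{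 even}),$$ with $K_\nu$ the modified Bessel function of the second kind. $\mathcal{L}_s(\mathbb{H}^n)$ denotes the set of measurable $u:\mathbb{H}^n\to\mathbb{R}$ with $\int_{\mathbb{H}^n}|u(\xi)|\,\mathcal{K}_{n,s}(1+d(\xi,o))\,d\xi<\infty$, so that the integral defining $(-\Delta_{\mathbb{H}^n})^su(x)$ converges at infinity. *)

theory Defs
  imports "HOL-Analysis.Analysis"
begin

section \<open>Hyperbolic space: the Poincare ball model\<close>

text \<open>
  Hyperbolic \<open>n\<close>-space of curvature \<open>-1\<close> is the open unit ball of an \<open>n\<close>-dimensional Euclidean
  space with the metric \<open>4 |dx|\<^sup>2 / (1 - |x|\<^sup>2)\<^sup>2\<close>.  Its topology is the Euclidean one, and, since the
  ball is a global chart, so are the local notions of regularity.  Functions on hyperbolic space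
  are functions on the whole vector space of which only the values on \<open>hyp_space\<close> are used.
\<close>

definition hyp_space :: "'a::euclidean_space set" where
  "hyp_space = ball 0 1"

definition hyp_dist :: "'a::euclidean_space \<Rightarrow> 'a \<Rightarrow> real" where
  "hyp_dist x y =
     arcosh (1 + 2 * (norm (x - y))\<^sup>2 / ((1 - (norm x)\<^sup>2) * (1 - (norm y)\<^sup>2)))"

text \<open>
  The density is the square root of the determinant of the metric.  Lebesgue (not only Borel)
  measurable functions are measurable for this measure.
\<close>

definition hyp_volume :: "'a::euclidean_space measure" where
  "hyp_volume = density (lebesgue_on hyp_space)
     (\<lambda>x. ennreal ((2 / (1 - (norm x)\<^sup>2)) ^ DIM('a)))"

definition hyp_bounded :: "'a::euclidean_space set \<Rightarrow> bool" where
  "hyp_bounded S \<longleftrightarrow> (\<exists>R. \<forall>x\<in>S. \<forall>y\<in>S. hyp_dist x y \<le> R)"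

definition hyp_bounded_domain :: "'a::euclidean_space set \<Rightarrow> bool" where
  "hyp_bounded_domain \<Omega> \<longleftrightarrow>
     \<Omega> \<subseteq> hyp_space \<and> open \<Omega> \<and> connected \<Omega> \<and> \<Omega> \<noteq> {} \<and> hyp_bounded \<Omega>"

definition hyp_closure :: "'a::euclidean_space set \<Rightarrow> 'a set" where
  "hyp_closure S = closure S \<inter> hyp_space"

section \<open>The kernel\<close>

text \<open>
  The modified Bessel function of the second kind, for positive argument, through its classical
  integral representation, valid for every real order (integer orders included).
\<close>

definition bessel_K :: "real \<Rightarrow> real \<Rightarrow> real" where
  "bessel_K \<nu> z = (LBINT t:{0<..}. exp (- z * cosh t) * cosh (\<nu> * t))"

definition neg_deriv_sinh :: "(real \<Rightarrow> real) \<Rightarrow> real \<Rightarrow> real" where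
  "neg_deriv_sinh f = (\<lambda>r. - deriv f r / sinh r)"

definition bessel_profile :: "nat \<Rightarrow> real \<Rightarrow> real \<Rightarrow> real" where
  "bessel_profile n s =
     (\<lambda>r. r powr (- ((1 + 2 * s) / 2)) * bessel_K ((1 + 2 * s) / 2) ((real n - 1) / 2 * r))"

text \<open>Only \<open>n \<ge> 2\<close> and positive \<open>\<rho>\<close> are meaningful.\<close>

definition hyp_kernel :: "nat \<Rightarrow> real \<Rightarrow> real \<Rightarrow> real" where
  "hyp_kernel n s \<rho> =
     (if odd n then (neg_deriv_sinh ^^ ((n - 1) div 2)) (bessel_profile n s) \<rho>
      else (LBINT r:{\<rho><..}. sinh r / sqrt (cosh r - cosh \<rho>) *
              (neg_deriv_sinh ^^ (n div 2)) (bessel_profile n s) r))"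

section \<open>The fractional Laplacian\<close>

text \<open>
  The Lebesgue integral of a real function with values in the extended reals.  Thus a divergent
  integral is \<open>\<infinity>\<close> or \<open>-\<infinity>\<close> rather than the conventional value \<open>0\<close> of the Bochner integral;
  for integrable functions the two agree.
\<close>

definition hyp_integral :: "('a::euclidean_space \<Rightarrow> real) \<Rightarrow> ereal" where
  "hyp_integral f =
     enn2ereal (\<integral>\<^sup>+ \<xi>. ennreal (f \<xi>) \<partial>hyp_volume) - enn2ereal (\<integral>\<^sup>+ \<xi>. ennreal (- f \<xi>) \<partial>hyp_volume)"

text \<open>
  The principal value is the limit, as \<open>\<epsilon>\<close> decreases to \<open>0\<close>, of the integrals over the complement
  of the geodesic ball of radius \<open>\<epsilon>\<close> about \<open>x\<close>.  The number \<open>C\<close> is the normalization constant; it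
  also absorbs the positive constant up to which the kernel is given.
\<close>

definition hyp_frac_laplacian ::
    "real \<Rightarrow> real \<Rightarrow> ('a::euclidean_space \<Rightarrow> real) \<Rightarrow> 'a \<Rightarrow> ereal" where
  "hyp_frac_laplacian C s u x =
     ereal C * Lim (at_right 0) (\<lambda>\<epsilon>.
       hyp_integral (\<lambda>\<xi>. indicat_real {\<xi>. \<epsilon> \<le> hyp_dist x \<xi>} \<xi> *
         ((u x - u \<xi>) * hyp_kernel DIM('a) s (hyp_dist x \<xi>))))"

section \<open>Function classes\<close>

text \<open>The space \<open>\<L>\<^sub>s\<close> with base point \<open>p\<close>.\<close>

definition hyp_L :: "real \<Rightarrow> 'a::euclidean_space \<Rightarrow> ('a \<Rightarrow> real) set" where
  "hyp_L s p = {u \<in> borel_measurable hyp_volume.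
     (\<integral>\<^sup>+ \<xi>. ennreal (\<bar>u \<xi>\<bar> * hyp_kernel DIM('a) s (1 + hyp_dist \<xi> p)) \<partial>hyp_volume) < \<infinity>}"

text \<open>
  Differentiable functions whose gradient is Lipschitz on compact subsets; on such subsets the
  Euclidean and the hyperbolic metric are comparable.
\<close>

definition C11_loc :: "'a::euclidean_space set \<Rightarrow> ('a \<Rightarrow> real) set" where
  "C11_loc \<Omega> = {u. \<exists>g. (\<forall>x\<in>\<Omega>. GDERIV u x :> g x) \<and>
     (\<forall>S. compact S \<and> S \<subseteq> \<Omega> \<longrightarrow> (\<exists>L. L-lipschitz_on S g))}"

definition lsc_on :: "'a::topological_space set \<Rightarrow> ('a \<Rightarrow> real) \<Rightarrow> bool" where
  "lsc_on S u \<longleftrightarrow> (\<forall>x\<in>S. \<forall>a<u x. \<forall>\<^sub>F y in at x within S. a < u y)"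

end

theory Submission
  imports Defs
begin

text \<open>
  By lower semicontinuity and compactness, a function that is negative somewhere attains its
  global minimum at a point of \<open>\<Omega>\<close>.  There the integrand of the fractional Laplacian is nonpositive,
  so the truncated integrals decrease as \<open>\<epsilon>\<close> tends to \<open>0\<close>; a nonnegative limit forces all of them
  to vanish, and positivity of the kernel makes \<open>u\<close> constant almost everywhere.  A negative constant
  contradicts \<open>u \<ge> 0\<close> outside \<open>\<Omega>\<close>, a set of positive measure.

  The kernel is positive because \<open>r powr (- \<nu>) * K\<^sub>\<nu> (c * r)\<close> is completely monotone in \<open>r\<close>, \<open>K\<^sub>\<nu>\<close> being a
  mixture of exponentials.  It stays completely monotone in the variable \<open>cosh r\<close>, whose derivative
  operator is \<open>(1 / sinh r) d/dr\<close>, since \<open>1 / sinh r = 1 / (2 sinh (r/2) cosh (r/2))\<close> is itself completely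
  monotone in \<open>cosh r\<close>.
\<close>

section \<open>Complete monotonicity\<close>

text \<open>For \<open>w = sinh\<close> this is complete monotonicity up to order \<open>k\<close>, with strict signs, in the
  variable \<open>cosh r\<close>; for \<open>w = 1\<close> it is the usual notion in the variable \<open>r\<close>.\<close>

primrec strict_cm :: "(real \<Rightarrow> real) \<Rightarrow> nat \<Rightarrow> (real \<Rightarrow> real) \<Rightarrow> bool" where
  "strict_cm w 0 f \<longleftrightarrow> (\<forall>r>0. f r > 0)"
| "strict_cm w (Suc k) f \<longleftrightarrow> (\<forall>r>0. f r > 0) \<and>
     (\<exists>g. strict_cm w k g \<and> (\<forall>r>0. (f has_real_derivative - (w r * g r)) (at r)))"

declare strict_cm.simps(2) [simp del]

section \<open>Closure of the class under equality on the half-line, sums and products\<close>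

lemma strict_cm_pos: "strict_cm w k f \<Longrightarrow> r > 0 \<Longrightarrow> f r > 0"
  by (cases k) (auto simp: strict_cm.simps(2))

lemma strict_cm_SucI:
  assumes "\<And>r. r > 0 \<Longrightarrow> f r > 0" "strict_cm w k g"
    and "\<And>r. r > 0 \<Longrightarrow> (f has_real_derivative - (w r * g r)) (at r)"
  shows "strict_cm w (Suc k) f"
  using assms unfolding strict_cm.simps(2) by blast

lemma strict_cm_SucE:
  assumes "strict_cm w (Suc k) f"
  obtains g where "strict_cm w k g"
    "\<And>r. r > 0 \<Longrightarrow> (f has_real_derivative - (w r * g r)) (at r)"
  using assms unfolding strict_cm.simps(2) by blast

text \<open>Serves the product rule, where a factor left undifferentiated is needed at the lower
  order.\<close>

lemma strict_cm_Suc_imp: "strict_cm w (Suc k) f \<Longrightarrow> strict_cm w k f"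
proof (induction k arbitrary: f)
  case (Suc k)
  from Suc.prems obtain g where g: "strict_cm w (Suc k) g"
    "\<And>r. r > 0 \<Longrightarrow> (f has_real_derivative - (w r * g r)) (at r)"
    by (rule strict_cm_SucE) (rule that)
  show ?case
    by (rule strict_cm_SucI[OF _ Suc.IH[OF g(1)] g(2)]) (use strict_cm_pos[OF Suc.prems] in auto)
qed (simp add: strict_cm.simps(2))

text \<open>The half-line \<open>r > 0\<close> is open, so the derivatives at its points depend only
  on the values there.\<close>

lemma strict_cm_cong:
  assumes "strict_cm w k f" and eq: "\<And>r. r > 0 \<Longrightarrow> f r = h r"
  shows "strict_cm w k h"
proof (cases k)
  case 0
  then show ?thesis using assms by simp
next
  case (Suc j)
  from assms(1)[unfolded Suc] obtain g where g: "strict_cm w j g"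
    "\<And>r. r > 0 \<Longrightarrow> (f has_real_derivative - (w r * g r)) (at r)"
    by (rule strict_cm_SucE) (rule that)
  have "(h has_real_derivative - (w r * g r)) (at r)" if "r > 0" for r
    by (rule has_field_derivative_transform_within_open[OF g(2)[OF that], of "{0<..}"])
      (use that eq in auto)
  moreover have "h r > 0" if "r > 0" for r
    using strict_cm_pos[OF assms(1) that] eq[OF that] by simp
  ultimately show ?thesis
    unfolding Suc by (intro strict_cm_SucI[OF _ g(1)])
qed

lemma strict_cm_add:
  "strict_cm w k f \<Longrightarrow> strict_cm w k h \<Longrightarrow> strict_cm w k (\<lambda>r. f r + h r)"
proof (induction k arbitrary: f h)
  case (Suc k)
  from Suc.prems(1) obtain f' where f': "strict_cm w k f'"
    and df: "\<And>r. r > 0 \<Longrightarrow> (f has_real_derivative - (w r * f' r)) (at r)"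
    by (rule strict_cm_SucE) (rule that)
  from Suc.prems(2) obtain h' where h': "strict_cm w k h'"
    and dh: "\<And>r. r > 0 \<Longrightarrow> (h has_real_derivative - (w r * h' r)) (at r)"
    by (rule strict_cm_SucE) (rule that)
  show ?case
  proof (rule strict_cm_SucI[OF _ Suc.IH[OF f' h']])
    fix r :: real assume r: "r > 0"
    show "f r + h r > 0"
      using strict_cm_pos[OF Suc.prems(1) r] strict_cm_pos[OF Suc.prems(2) r] by simp
    show "((\<lambda>r. f r + h r) has_real_derivative - (w r * (f' r + h' r))) (at r)"
      by (rule DERIV_cong[OF DERIV_add[OF df[OF r] dh[OF r]]]) (simp add: algebra_simps)
  qed
qed (auto intro: add_pos_pos)

text \<open>By the Leibniz rule the next function is \<open>f' * h + f * h'\<close>, a sum of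
  products to which the induction hypothesis applies at order \<open>k\<close>.\<close>

lemma strict_cm_mult:
  "strict_cm w k f \<Longrightarrow> strict_cm w k h \<Longrightarrow> strict_cm w k (\<lambda>r. f r * h r)"
proof (induction k arbitrary: f h)
  case (Suc k)
  from Suc.prems(1) obtain f' where f': "strict_cm w k f'"
    and df: "\<And>r. r > 0 \<Longrightarrow> (f has_real_derivative - (w r * f' r)) (at r)"
    by (rule strict_cm_SucE) (rule that)
  from Suc.prems(2) obtain h' where h': "strict_cm w k h'"
    and dh: "\<And>r. r > 0 \<Longrightarrow> (h has_real_derivative - (w r * h' r)) (at r)"
    by (rule strict_cm_SucE) (rule that)
  show ?case
  proof (rule strict_cm_SucI)
    show "strict_cm w k (\<lambda>r. f' r * h r + f r * h' r)"
      by (intro strict_cm_add Suc.IH f' h' strict_cm_Suc_imp[OF Suc.prems(1)]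
          strict_cm_Suc_imp[OF Suc.prems(2)])
    fix r :: real assume r: "r > 0"
    show "f r * h r > 0"
      using strict_cm_pos[OF Suc.prems(1) r] strict_cm_pos[OF Suc.prems(2) r] by simp
    show "((\<lambda>r. f r * h r) has_real_derivative - (w r * (f' r * h r + f r * h' r))) (at r)"
      by (rule DERIV_cong[OF DERIV_mult[OF df[OF r] dh[OF r]]]) (simp add: algebra_simps)
  qed
qed (auto intro: mult_pos_pos)

section \<open>Concrete completely monotone functions and the passage to the variable
  \<open>cosh r\<close>\<close>

lemma sinh_half_double: "sinh (r :: real) = 2 * sinh (r/2) * cosh (r/2)"
  using sinh_double[of "r/2"] by simp

text \<open>In \<open>y = cosh r\<close> this is a positive multiple of a negative power of
  \<open>y - 1\<close>. Dividing the derivative by \<open>sinh r = 2 sinh (r/2) cosh (r/2)\<close>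
  cancels \<open>cosh (r/2)\<close>: the exponent rises by 2 and the constant becomes
  \<open>c * (m + 1) / 4\<close>.\<close>

lemma strict_cm_inverse_sinh_half_power:
  "c > 0 \<Longrightarrow> strict_cm sinh k (\<lambda>r. c * inverse (sinh (r/2)) ^ Suc m)"
proof (induction k arbitrary: m c)
  case (Suc k)
  show ?case
  proof (rule strict_cm_SucI)
    show "strict_cm sinh k (\<lambda>r. c * real (Suc m) / 4 * inverse (sinh (r/2)) ^ Suc (Suc (Suc m)))"
      by (rule Suc.IH) (use Suc.prems in simp)
    fix r :: real
    assume r: "r > 0"
    show "c * inverse (sinh (r/2)) ^ Suc m > 0"
      using r Suc.prems by (intro mult_pos_pos zero_less_power) auto
    have "((\<lambda>r. inverse (sinh (r/2))) has_real_derivative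
        - (cosh (r/2) / 2 * inverse (sinh (r/2)) ^ 2)) (at r)"
      using r by (auto intro!: derivative_eq_intros simp: field_simps power2_eq_square)
    from DERIV_cmult[OF DERIV_power_Suc[OF this, of m], of c]
    show "((\<lambda>r. c * inverse (sinh (r/2)) ^ Suc m) has_real_derivative
        - (sinh r * (c * real (Suc m) / 4 * inverse (sinh (r/2)) ^ Suc (Suc (Suc m))))) (at r)"
      unfolding sinh_half_double[of r]
      by (rule DERIV_cong) (use r in \<open>simp add: power2_eq_square field_simps\<close>)
  qed
qed (auto intro!: mult_pos_pos zero_less_power)

text \<open>The same computation with \<open>y + 1\<close> for \<open>y - 1\<close>; here
  \<open>sinh (r/2)\<close> cancels.\<close>

lemma strict_cm_inverse_cosh_half_power:
  "c > 0 \<Longrightarrow> strict_cm sinh k (\<lambda>r. c * inverse (cosh (r/2)) ^ Suc m)"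
proof (induction k arbitrary: m c)
  case (Suc k)
  show ?case
  proof (rule strict_cm_SucI)
    show "strict_cm sinh k (\<lambda>r. c * real (Suc m) / 4 * inverse (cosh (r/2)) ^ Suc (Suc (Suc m)))"
      by (rule Suc.IH) (use Suc.prems in simp)
    fix r :: real
    assume r: "r > 0"
    show "c * inverse (cosh (r/2)) ^ Suc m > 0"
      using r Suc.prems by (intro mult_pos_pos zero_less_power) auto
    have "((\<lambda>r. inverse (cosh (r/2))) has_real_derivative
        - (sinh (r/2) / 2 * inverse (cosh (r/2)) ^ 2)) (at r)"
      using r by (auto intro!: derivative_eq_intros simp: field_simps power2_eq_square)
    from DERIV_cmult[OF DERIV_power_Suc[OF this, of m], of c]
    show "((\<lambda>r. c * inverse (cosh (r/2)) ^ Suc m) has_real_derivative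
        - (sinh r * (c * real (Suc m) / 4 * inverse (cosh (r/2)) ^ Suc (Suc (Suc m))))) (at r)"
      unfolding sinh_half_double[of r]
      by (rule DERIV_cong) (use r in \<open>simp add: power2_eq_square field_simps\<close>)
  qed
qed (auto intro!: mult_pos_pos zero_less_power)

lemma strict_cm_inverse_sinh: "strict_cm sinh k (\<lambda>r. inverse (sinh r))"
proof -
  have "strict_cm sinh k (\<lambda>r. (1/2 * inverse (sinh (r/2)) ^ Suc 0) * (1 * inverse (cosh (r/2)) ^ Suc 0))"
    by (intro strict_cm_mult strict_cm_inverse_sinh_half_power strict_cm_inverse_cosh_half_power) auto
  then show ?thesis
    by (rule strict_cm_cong) (subst (2) sinh_half_double, simp)
qed

text \<open>If \<open>f\<close> has derivative \<open>- g\<close>, the function following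
  \<open>f\<close> for the weight \<open>sinh\<close> is \<open>g / sinh\<close>, a product of two
  completely monotone functions in \<open>cosh r\<close>: \<open>g\<close> by induction and
  \<open>1 / sinh\<close> by the previous lemma.\<close>

lemma strict_cm_sinh_of_one: "strict_cm (\<lambda>_. 1) k f \<Longrightarrow> strict_cm sinh k f"
proof (induction k arbitrary: f)
  case (Suc k)
  from Suc.prems obtain g where g: "strict_cm (\<lambda>_. 1) k g"
    "\<And>r. r > 0 \<Longrightarrow> (f has_real_derivative - (1 * g r)) (at r)"
    by (rule strict_cm_SucE) (rule that)
  show ?case
  proof (rule strict_cm_SucI)
    show "strict_cm sinh k (\<lambda>r. g r * inverse (sinh r))"
      by (intro strict_cm_mult Suc.IH g strict_cm_inverse_sinh)
    fix r :: real assume r: "r > 0"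
    show "f r > 0" by (rule strict_cm_pos[OF Suc.prems r])
    show "(f has_real_derivative - (sinh r * (g r * inverse (sinh r)))) (at r)"
      by (rule DERIV_cong[OF g(2)[OF r]]) (use r in simp)
  qed
qed simp

text \<open>The constant \<open>c\<close> is there for the induction, which absorbs the factor
  \<open>a\<close> of the derivative into it.\<close>

lemma strict_cm_powr:
  fixes a c :: real
  assumes "c > 0" "a > 0"
  shows "strict_cm (\<lambda>_. 1) k (\<lambda>r. c * r powr (- a))"
  using assms
proof (induction k arbitrary: c a)
  case (Suc k)
  show ?case
  proof (rule strict_cm_SucI)
    show "strict_cm (\<lambda>_. 1) k (\<lambda>r. c * a * r powr - (a + 1))"
      by (rule Suc.IH) (use Suc.prems in auto)
    fix r :: real assume r: "r > 0"
    show "c * r powr (- a) > 0" using r Suc.prems by simp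
    have "- a - 1 = - (a + 1)" by simp
    then show "((\<lambda>r. c * r powr (- a)) has_real_derivative - (1 * (c * a * r powr - (a + 1)))) (at r)"
      using DERIV_cmult[OF has_real_derivative_powr[OF r, of "- a"], of c]
      by (simp only: minus_mult_left[symmetric] minus_mult_right[symmetric] mult.assoc mult_1_left)
  qed
qed simp

text \<open>As \<open>sinh r\<close> is nonzero for \<open>r > 0\<close>, the function
  \<open>g\<close> of the definition is determined on the half-line. This ties the abstract notion
  to the operator iterated in the kernel, each application using up one order.\<close>

lemma neg_deriv_sinh_strict_cm:
  assumes "strict_cm sinh (Suc k) f"
  shows "strict_cm sinh k (neg_deriv_sinh f)"
    and "\<And>r. r > 0 \<Longrightarrow> (f has_real_derivative - (sinh r * neg_deriv_sinh f r)) (at r)"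
proof -
  from assms obtain g where g: "strict_cm sinh k g"
    "\<And>r. r > 0 \<Longrightarrow> (f has_real_derivative - (sinh r * g r)) (at r)"
    by (rule strict_cm_SucE) (rule that)
  have eq: "g r = neg_deriv_sinh f r" if "r > 0" for r
    using DERIV_imp_deriv[OF g(2)[OF that]] that by (simp add: neg_deriv_sinh_def)
  show "strict_cm sinh k (neg_deriv_sinh f)"
    using strict_cm_cong[OF g(1) eq] .
  show "\<And>r. r > 0 \<Longrightarrow> (f has_real_derivative - (sinh r * neg_deriv_sinh f r)) (at r)"
    using g(2) eq by simp
qed

lemma funpow_neg_deriv_sinh_strict_cm:
  "strict_cm sinh (m + k) f \<Longrightarrow> strict_cm sinh k ((neg_deriv_sinh ^^ m) f)"
proof (induction m arbitrary: k)
  case (Suc m)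
  then have "strict_cm sinh (Suc k) ((neg_deriv_sinh ^^ m) f)" by simp
  then show ?case using neg_deriv_sinh_strict_cm(1) by simp
qed simp

section \<open>Laplace integrals\<close>

text \<open>Multiplying \<open>1 - x \<le> exp (- x)\<close> by \<open>exp x\<close> gives
  \<open>exp x - 1 \<le> x * exp x\<close>, from which both signs of \<open>x\<close> follow. The
  bound controls difference quotients of Laplace integrals.\<close>

lemma exp_Taylor1_bound: "\<bar>exp x - 1 - x\<bar> \<le> x\<^sup>2 * exp \<bar>x\<bar>" for x :: real
proof -
  have 1: "0 \<le> exp x - 1 - x" using exp_ge_add_one_self[of x] by linarith
  have "(1 - x) * exp x \<le> exp (- x) * exp x"
    using exp_ge_add_one_self[of "-x"] by (intro mult_right_mono) auto
  then have 2: "exp x - 1 \<le> x * exp x" by (simp add: algebra_simps flip: exp_add)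
  show ?thesis
  proof (cases "x \<ge> 0")
    case True
    have "exp x - 1 - x \<le> x * exp x - x" using 2 by simp
    also have "\<dots> = x * (exp x - 1)" by (simp add: algebra_simps)
    also have "\<dots> \<le> x * (x * exp x)" using 2 True by (intro mult_left_mono) auto
    finally show ?thesis using 1 True by (simp add: power2_eq_square)
  next
    case False
    have "exp x - 1 - x \<le> x * exp x - x" using 2 by simp
    also have "\<dots> = - x * (1 - exp x)" by (simp add: algebra_simps)
    also have "\<dots> \<le> - x * (- x)"
      using 1 False by (intro mult_left_mono) auto
    also have "\<dots> \<le> x\<^sup>2 * exp \<bar>x\<bar>"
      using mult_left_mono[of 1 "exp \<bar>x\<bar>" "x\<^sup>2"] by (simp add: power2_eq_square)
    finally show ?thesis using 1 by simp
  qed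
qed

text \<open>The second-order remainder of \<open>exp (- a t * h)\<close> is at most
  \<open>(a t * h)\<^sup>2 * exp (a t * \<bar>h\<bar>)\<close>. For
  \<open>\<bar>h\<bar> < r/2\<close> the exponential costs only half of the decay
  \<open>exp (- a t * r)\<close>, so the difference quotient is off by at most
  \<open>\<bar>h\<bar>\<close> times the moment of order \<open>k + 2\<close> at \<open>r/2\<close>,
  which is finite by \<open>int\<close>.\<close>

lemma has_real_derivative_laplace_integral:
  fixes M :: "'b measure" and g a :: "'b \<Rightarrow> real"
  assumes int: "\<And>k r. r > 0 \<Longrightarrow> integrable M (\<lambda>t. g t * a t ^ k * exp (- a t * r))"
    and "\<And>t. g t \<ge> 0" "\<And>t. a t \<ge> 0" and r: "r > 0"
  shows "((\<lambda>r. \<integral>t. g t * a t ^ k * exp (- a t * r) \<partial>M) has_real_derivative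
    - (\<integral>t. g t * a t ^ Suc k * exp (- a t * r) \<partial>M)) (at r)"
proof -
  define F where "F = (\<lambda>k r. \<integral>t. g t * a t ^ k * exp (- a t * r) \<partial>M)"
  define B where "B = F (k + 2) (r/2)"
  have bound: "\<bar>(F k (r + h) - F k r) / h - (- F (Suc k) r)\<bar> \<le> B * \<bar>h\<bar>" if h: "h \<noteq> 0" "\<bar>h\<bar> < r/2" for h
  proof -
    have rh: "r + h > 0" "r / 2 > 0" using h r by auto
    let ?d = "\<lambda>t. g t * a t ^ k * exp (- a t * r) * (exp (- a t * h) - 1 - (- a t * h))"
    have eq: "F k (r + h) - F k r + h * F (Suc k) r = (\<integral>t. ?d t \<partial>M)"
      unfolding F_def
      by (subst integral_mult_right_zero[symmetric], subst Bochner_Integration.integral_diff[symmetric],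
          (intro int rh r)+, subst Bochner_Integration.integral_add[symmetric],
          (intro int rh r Bochner_Integration.integrable_diff integrable_mult_right)+,
          intro Bochner_Integration.integral_cong refl)
        (simp add: algebra_simps flip: exp_add)
    have "\<bar>\<integral>t. ?d t \<partial>M\<bar> \<le> (\<integral>t. \<bar>?d t\<bar> \<partial>M)" by (rule integral_abs_bound)
    also have "\<dots> \<le> (\<integral>t. h\<^sup>2 * (g t * a t ^ (k+2) * exp (- a t * (r/2))) \<partial>M)"
    proof (rule integral_mono')
      show "integrable M (\<lambda>t. h\<^sup>2 * (g t * a t ^ (k+2) * exp (- a t * (r/2))))"
        by (intro integrable_mult_right int rh)
      fix t
      have "\<bar>exp (- a t * h) - 1 - (- a t * h)\<bar> \<le> (- a t * h)\<^sup>2 * exp \<bar>- a t * h\<bar>"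
        by (rule exp_Taylor1_bound)
      also have "\<dots> \<le> (- a t * h)\<^sup>2 * exp (a t * (r/2))"
      proof -
        have "a t * \<bar>h\<bar> \<le> a t * (r/2)" using h assms(3)[of t] by (intro mult_left_mono) auto
        then show ?thesis using assms(3)[of t] by (intro mult_left_mono) (auto simp: abs_mult)
      qed
      finally have "\<bar>?d t\<bar> \<le> g t * a t ^ k * exp (- a t * r) * ((- a t * h)\<^sup>2 * exp (a t * (r/2)))"
        using assms(2,3) by (auto simp: abs_mult intro!: mult_left_mono)
      also have "\<dots> = h\<^sup>2 * (g t * a t ^ (k+2) * (exp (- a t * r) * exp (a t * (r/2))))"
        by (simp add: power2_eq_square algebra_simps)
      also have "exp (- a t * r) * exp (a t * (r/2)) = exp (- a t * (r/2))"
        by (simp add: field_simps flip: exp_add)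
      finally show "\<bar>?d t\<bar> \<le> h\<^sup>2 * (g t * a t ^ (k+2) * exp (- a t * (r/2)))" .
    qed (use assms in auto)
    also have "\<dots> = h\<^sup>2 * B" by (simp add: B_def F_def)
    finally have "\<bar>F k (r + h) - F k r + h * F (Suc k) r\<bar> \<le> h\<^sup>2 * B" unfolding eq .
    moreover have "(F k (r + h) - F k r) / h - (- F (Suc k) r) = (F k (r + h) - F k r + h * F (Suc k) r) / h"
      using h by (simp add: field_simps)
    ultimately show ?thesis
      using h by (simp add: pos_divide_le_eq power2_eq_square mult.assoc mult.commute mult.left_commute)
  qed
  have "(\<lambda>h. (F k (r + h) - F k r) / h - (- F (Suc k) r)) \<midarrow>0\<rightarrow> 0"
  proof (rule Lim_null_comparison)
    show "\<forall>\<^sub>F h in at 0. norm ((F k (r + h) - F k r) / h - - F (Suc k) r) \<le> B * \<bar>h\<bar>"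
      unfolding eventually_at using bound r by (intro exI[of _ "r/2"]) (auto simp: dist_real_def)
    show "(\<lambda>h. B * \<bar>h\<bar>) \<midarrow>0\<rightarrow> 0" by (auto intro!: tendsto_eq_intros)
  qed
  then show ?thesis
    unfolding DERIV_def F_def by (rule LIM_zero_cancel)
qed

text \<open>Differentiation raises \<open>k\<close> by one and changes the sign, so the induction on
  \<open>j\<close> runs over all \<open>k\<close> at once. Strictness comes from \<open>ne\<close>:
  a vanishing integral of a nonnegative integrand would force \<open>g = 0\<close> almost
  everywhere.\<close>

lemma strict_cm_laplace_integral:
  fixes M :: "'b measure" and g a :: "'b \<Rightarrow> real"
  assumes int: "\<And>k r. r > 0 \<Longrightarrow> integrable M (\<lambda>t. g t * a t ^ k * exp (- a t * r))"
    and "\<And>t. g t \<ge> 0" "\<And>t. a t > 0" and ne: "\<not> (AE t in M. g t = 0)"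
  shows "strict_cm (\<lambda>_. 1) j (\<lambda>r. \<integral>t. g t * a t ^ k * exp (- a t * r) \<partial>M)"
proof -
  have pos: "(\<integral>t. g t * a t ^ k * exp (- a t * r) \<partial>M) > 0" if "r > 0" for k r
  proof -
    let ?f = "\<lambda>t. g t * a t ^ k * exp (- a t * r)"
    have nn: "?f t \<ge> 0" for t using assms(2)[of t] assms(3)[of t] by simp
    have "(\<integral>t. ?f t \<partial>M) \<noteq> 0"
    proof
      assume "(\<integral>t. ?f t \<partial>M) = 0"
      then have "AE t in M. ?f t = 0"
        using integral_nonneg_eq_0_iff_AE[OF int[OF that]] nn by auto
      then have "AE t in M. g t = 0"
        by eventually_elim (metis assms(3) exp_not_eq_zero less_irrefl mult_eq_0_iff power_not_zero)
      with ne show False ..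
    qed
    moreover have "(\<integral>t. ?f t \<partial>M) \<ge> 0" using nn by (intro Bochner_Integration.integral_nonneg)
    ultimately show ?thesis by linarith
  qed
  show ?thesis
  proof (induction j arbitrary: k)
    case (Suc j)
    show ?case
      by (rule strict_cm_SucI[OF pos Suc.IH[of "Suc k"]])
        (use has_real_derivative_laplace_integral[OF int assms(2) less_imp_le[OF assms(3)]] in simp_all)
  qed (use pos in auto)
qed

section \<open>Positivity of the kernel\<close>

lemma borel_measurable_sinh_real [measurable]: "sinh \<in> borel_measurable (borel :: real measure)"
  by (intro borel_measurable_continuous_onI continuous_intros)

lemma borel_measurable_cosh_real [measurable]: "cosh \<in> borel_measurable (borel :: real measure)"
  by (intro borel_measurable_continuous_onI continuous_intros)

text \<open>The factor \<open>exp (- c * r * cosh t)\<close> decays doubly exponentially and thus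
  beats any power of \<open>exp t\<close>; the integrand is dominated by a multiple of
  \<open>exp (- t)\<close>.\<close>

lemma integrable_bessel_integrand:
  fixes \<nu> c r :: real
  assumes "\<nu> > 0" "c > 0" "r > 0"
  shows "integrable lborel (\<lambda>t. (indicat_real {0<..} t * cosh (\<nu> * t)) * (c * cosh t) ^ k * exp (- (c * cosh t) * r))"
proof -
  \<comment> \<open>\<open>N\<close> is large enough for \<open>\<nu> + k - N \<le> - 1\<close>, and
    \<open>b\<close> satisfies \<open>N * b = c * r / 2\<close>, so that
    \<open>exp (- c * r * exp t / 2)\<close> is the inverse of \<open>exp (b * exp t) ^ N\<close>,
    to be compared with \<open>(b * exp t) ^ N\<close>.\<close>
  define N where "N = nat \<lceil>\<nu>\<rceil> + k + 1"
  have N: "real N \<ge> \<nu> + real k + 1" "N > 0" unfolding N_def using assms(1) by (auto; linarith)+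
  define b where "b = c * r / (2 * real N)"
  have b: "b > 0" using assms N by (simp add: b_def)
  define D where "D = c ^ k / b ^ N"
  have D: "D > 0" using assms b by (simp add: D_def)
  have int: "integrable lborel (\<lambda>t. D * (indicat_real {0<..} t * exp (- t)))"
  proof -
    have "set_integrable lborel (einterval 0 \<infinity>) (\<lambda>t. exp (- t) :: real)"
    proof (rule interval_integral_FTC_nonneg)
      show "((\<lambda>t. - exp (- t)) has_real_derivative exp (- t)) (at t)" for t :: real
        by (auto intro!: derivative_eq_intros)
      show "(((\<lambda>t. - exp (- t)) \<circ> real_of_ereal) \<longlongrightarrow> - 1) (at_right (0::ereal))"
        unfolding zero_ereal_def ereal_tendsto_simps1
        by (auto intro!: tendsto_eq_intros)
      show "(((\<lambda>t. - exp (- t)) \<circ> real_of_ereal) \<longlongrightarrow> 0) (at_left (\<infinity>::ereal))"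
        unfolding ereal_tendsto_simps1
        using tendsto_minus[OF filterlim_compose[OF exp_at_bot filterlim_uminus_at_bot_at_top]] by simp
    qed (auto intro!: continuous_intros)
    moreover have "einterval 0 \<infinity> = {0<..}"
      by (auto simp: einterval_def)
    ultimately show ?thesis
      unfolding set_integrable_def by simp
  qed
  show ?thesis
  proof (rule Bochner_Integration.integrable_bound[OF int])
    show "AE t in lborel. norm ((indicat_real {0<..} t * cosh (\<nu> * t)) * (c * cosh t) ^ k * exp (- (c * cosh t) * r))
      \<le> norm (D * (indicat_real {0<..} t * exp (- t)))"
    proof (rule AE_I2)
      fix t :: real
      show "norm ((indicat_real {0<..} t * cosh (\<nu> * t)) * (c * cosh t) ^ k * exp (- (c * cosh t) * r))
        \<le> norm (D * (indicat_real {0<..} t * exp (- t)))"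
      proof (cases "t > 0")
        case True
        have ch: "cosh x \<le> exp x" if "x \<ge> 0" for x :: real
          using that by (simp add: cosh_def)
        have 1: "cosh (\<nu> * t) \<le> exp (\<nu> * t)" using assms True by (intro ch) auto
        have 2: "(c * cosh t) ^ k \<le> (c * exp t) ^ k"
          using assms True ch[of t] by (intro power_mono mult_left_mono) auto
        have "exp (- (c * cosh t) * r) \<le> exp (- (c * r * exp t / 2))"
          using assms by (simp add: cosh_def field_simps)
        also have "\<dots> = inverse (exp (real N * (b * exp t)))"
          using N by (simp add: b_def exp_minus)
        also have "\<dots> \<le> inverse ((b * exp t) ^ N)"
        proof (rule le_imp_inverse_le)
          have "b * exp t \<le> exp (b * exp t)" using exp_ge_add_one_self[of "b * exp t"] by linarith
          then have "(b * exp t) ^ N \<le> exp (b * exp t) ^ N"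
            using b by (intro power_mono) auto
          then show "(b * exp t) ^ N \<le> exp (real N * (b * exp t))"
            by (simp add: exp_of_nat_mult)
        qed (use b in simp)
        also have "\<dots> = exp (- (real N * t)) / b ^ N"
          by (simp only: power_mult_distrib exp_minus exp_of_nat_mult inverse_mult_distrib) (simp add: field_simps)
        finally have 3: "exp (- (c * cosh t) * r) \<le> exp (- (real N * t)) / b ^ N" .
        have "cosh (\<nu> * t) * (c * cosh t) ^ k * exp (- (c * cosh t) * r)
          \<le> exp (\<nu> * t) * (c * exp t) ^ k * (exp (- (real N * t)) / b ^ N)"
          using 1 2 3 assms by (intro mult_mono) auto
        also have "\<dots> = D * (exp (\<nu> * t) * exp (real k * t) * exp (- (real N * t)))"
          by (simp add: D_def power_mult_distrib exp_of_nat_mult)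
        also have "exp (\<nu> * t) * exp (real k * t) * exp (- (real N * t)) = exp ((\<nu> + k - N) * t)"
          by (simp add: algebra_simps flip: exp_add)
        also have "\<dots> \<le> exp (- 1 * t)"
          unfolding exp_le_cancel_iff using N True by (intro mult_right_mono) auto
        finally show ?thesis using True D assms by (simp add: abs_mult)
      qed simp
    qed
  qed measurable
qed

text \<open>Used to rule out that a function positive on an interval vanishes almost
  everywhere.\<close>

lemma not_AE_notin_Ioo:
  fixes a b :: real
  assumes "a < b"
  shows "\<not> (AE t in lborel. t \<notin> {a<..<b})"
  using assms AE_iff_null_sets[of "{a<..<b}" lborel] by (simp add: null_sets_def del: greaterThanLessThan_iff)

text \<open>The integral representation of \<open>bessel_K \<nu> (c * r)\<close> is a Laplace
  integral in \<open>r\<close> with rate \<open>c * cosh t\<close> and weight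
  \<open>cosh (\<nu> * t)\<close> on \<open>t > 0\<close>, taken at \<open>k = 0\<close>. The rate
  is positive because \<open>n \<ge> 2\<close>.\<close>

lemma strict_cm_bessel_profile:
  assumes "n \<ge> 2" "s > 0"
  shows "strict_cm sinh k (bessel_profile n s)"
proof -
  define \<nu> where "\<nu> = (1 + 2 * s) / 2"
  define c where "c = (real n - 1) / 2"
  have pos: "\<nu> > 0" "c > 0" using assms by (auto simp: \<nu>_def c_def)
  let ?g = "\<lambda>t. indicat_real {0<..} t * cosh (\<nu> * t)"
  have "strict_cm (\<lambda>_. 1) k (\<lambda>r. \<integral>t. ?g t * (c * cosh t) ^ 0 * exp (- (c * cosh t) * r) \<partial>lborel)"
  proof (rule strict_cm_laplace_integral)
    show "integrable lborel (\<lambda>t. ?g t * (c * cosh t) ^ k * exp (- (c * cosh t) * r))" if "r > 0" for k r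
      by (rule integrable_bessel_integrand[OF pos that])
    show "\<not> (AE t in lborel. ?g t = 0)"
    proof
      assume "AE t in lborel. ?g t = 0"
      then have "AE t in lborel. t \<notin> {0<..<1::real}"
        by eventually_elim (auto simp: indicator_def split: if_splits)
      with not_AE_notin_Ioo[of 0 1] show False by simp
    qed
  qed (use pos in auto)
  moreover have "(\<integral>t. ?g t * (c * cosh t) ^ 0 * exp (- (c * cosh t) * r) \<partial>lborel) = bessel_K \<nu> (c * r)" for r
    unfolding bessel_K_def set_lebesgue_integral_def
    by (intro Bochner_Integration.integral_cong) (auto simp: algebra_simps)
  ultimately have "strict_cm (\<lambda>_. 1) k (\<lambda>r. (1 * r powr - \<nu>) * bessel_K \<nu> (c * r))"
    by (intro strict_cm_mult strict_cm_powr pos) auto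
  then show ?thesis
    unfolding bessel_profile_def \<nu>_def[symmetric] c_def[symmetric]
    by (intro strict_cm_sinh_of_one) simp
qed

section \<open>Convergence of the Abel-type integral of even dimensions\<close>

lemma strict_cm_antimono:
  assumes "strict_cm sinh (Suc k) f" "0 < x" "x \<le> y"
  shows "f y \<le> f x"
proof (rule DERIV_nonpos_imp_nonincreasing[where f = f])
  fix z assume "x \<le> z" "z \<le> y"
  with assms have z: "z > 0" by simp
  have "neg_deriv_sinh f z > 0"
    using strict_cm_pos[OF neg_deriv_sinh_strict_cm(1)[OF assms(1)] z] .
  with neg_deriv_sinh_strict_cm(2)[OF assms(1) z] z
  show "\<exists>y. (f has_real_derivative y) (at z) \<and> y \<le> 0"
    by (intro exI[of _ "- (sinh z * neg_deriv_sinh f z)"]) auto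
qed (use assms in auto)

lemma strict_cm_isCont:
  assumes "strict_cm sinh (Suc k) f" "0 < x"
  shows "isCont f x"
  using neg_deriv_sinh_strict_cm(2)[OF assms] DERIV_isCont by blast

text \<open>The integrand has the antiderivative \<open>2 * sqrt (cosh r - cosh \<rho>)\<close>,
  which stays finite at the singular endpoint.\<close>

lemma set_integrable_abel_near:
  fixes \<rho> :: real
  assumes "\<rho> > 0"
  shows "set_integrable lborel {\<rho><..<\<rho>+1} (\<lambda>r. sinh r / sqrt (cosh r - cosh \<rho>))"
proof -
  have "set_integrable lborel (einterval (ereal \<rho>) (ereal (\<rho>+1))) (\<lambda>r. sinh r / sqrt (cosh r - cosh \<rho>))"
  proof (rule interval_integral_FTC_nonneg)
    fix r assume "ereal \<rho> < ereal r" "ereal r < ereal (\<rho> + 1)"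
    then have r: "cosh r - cosh \<rho> > 0" "r > 0"
      using assms cosh_real_nonneg_less_iff[of \<rho> r] by auto
    show "((\<lambda>r. 2 * sqrt (cosh r - cosh \<rho>)) has_real_derivative sinh r / sqrt (cosh r - cosh \<rho>)) (at r)"
      using r by (auto intro!: derivative_eq_intros simp: field_simps)
    show "isCont (\<lambda>r. sinh r / sqrt (cosh r - cosh \<rho>)) r"
      using r by (intro continuous_intros) auto
  next
    show "AE r in lborel. ereal \<rho> < ereal r \<longrightarrow> ereal r < ereal (\<rho>+1) \<longrightarrow> 0 \<le> sinh r / sqrt (cosh r - cosh \<rho>)"
      using assms cosh_real_nonneg_le_iff[of \<rho>] by (intro AE_I2) auto
    \<comment> \<open>\<open>sqrt\<close> is continuous on the whole real line, negative arguments
      included, so the one-sided limits at both endpoints are restrictions of a full limit.\<close>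
    have "isCont (\<lambda>r. 2 * sqrt (cosh r - cosh \<rho>)) x" for x
      by (intro continuous_intros)
    then have *: "(\<lambda>r. 2 * sqrt (cosh r - cosh \<rho>)) \<midarrow>x\<rightarrow> 2 * sqrt (cosh x - cosh \<rho>)" for x
      unfolding isCont_def .
    show "(((\<lambda>r. 2 * sqrt (cosh r - cosh \<rho>)) \<circ> real_of_ereal) \<longlongrightarrow> 2 * sqrt (cosh \<rho> - cosh \<rho>)) (at_right (ereal \<rho>))"
      unfolding ereal_tendsto_simps1 by (rule tendsto_within_subset[OF *]) simp
    show "(((\<lambda>r. 2 * sqrt (cosh r - cosh \<rho>)) \<circ> real_of_ereal) \<longlongrightarrow> 2 * sqrt (cosh (\<rho>+1) - cosh \<rho>)) (at_left (ereal (\<rho>+1)))"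
      unfolding ereal_tendsto_simps1 by (rule tendsto_within_subset[OF *]) simp
  qed simp
  then show ?thesis by simp
qed

text \<open>The integrand is the derivative of \<open>- f\<close>, which increases and is bounded
  above by 0, hence converges at infinity. One order of monotonicity pays for the derivative, the
  second for its continuity.\<close>

lemma set_integrable_sinh_neg_deriv_sinh:
  assumes f: "strict_cm sinh (Suc (Suc k)) f" and "a > 0"
  shows "set_integrable lborel {a<..} (\<lambda>r. sinh r * neg_deriv_sinh f r)"
proof -
  note g = neg_deriv_sinh_strict_cm[OF f]
  define F where "F = (\<lambda>r. - f r)"
  have "\<exists>B. (F \<longlongrightarrow> B) at_top"
  proof -
    have "(F \<longlongrightarrow> (SUP x\<in>{a..}. F x)) at_top"
    proof (rule increasing_tendsto)
      have bdd: "bdd_above (F ` {a..})"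
        using strict_cm_pos[OF f] \<open>a > 0\<close> by (intro bdd_aboveI2[of _ _ 0]) (simp add: F_def less_imp_le)
      show "\<forall>\<^sub>F x in at_top. F x \<le> (SUP x\<in>{a..}. F x)"
        using eventually_ge_at_top[of a] by eventually_elim (auto intro!: cSUP_upper bdd)
      fix y assume "y < (SUP x\<in>{a..}. F x)"
      then obtain x where x: "x \<ge> a" "y < F x"
        using less_cSUP_iff[of "{a..}" F y] bdd by auto
      show "\<forall>\<^sub>F x in at_top. y < F x"
        using eventually_ge_at_top[of x]
      proof eventually_elim
        case (elim z)
        then have "F x \<le> F z" using strict_cm_antimono[OF f, of x z] x \<open>a > 0\<close> by (simp add: F_def)
        with x show ?case by simp
      qed
    qed
    then show ?thesis by blast
  qed
  then obtain B where B: "(F \<longlongrightarrow> B) at_top" by blast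
  have "set_integrable lborel (einterval (ereal a) \<infinity>) (\<lambda>r. sinh r * neg_deriv_sinh f r)"
  proof (rule interval_integral_FTC_nonneg)
    fix r assume "ereal a < ereal r"
    then have r: "r > 0" using \<open>a > 0\<close> by simp
    show "(F has_real_derivative sinh r * neg_deriv_sinh f r) (at r)"
      unfolding F_def by (rule DERIV_cong[OF DERIV_minus[OF g(2)[OF r]]]) simp
    show "isCont (\<lambda>r. sinh r * neg_deriv_sinh f r) r"
      using strict_cm_isCont[OF g(1) r] by (intro continuous_intros)
  next
    show "AE r in lborel. ereal a < ereal r \<longrightarrow> ereal r < \<infinity> \<longrightarrow> 0 \<le> sinh r * neg_deriv_sinh f r"
      using strict_cm_pos[OF g(1)] \<open>a > 0\<close> by (intro AE_I2) (auto simp: less_imp_le)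
    have "isCont F a"
      unfolding F_def using strict_cm_isCont[OF f \<open>a > 0\<close>] by (intro continuous_intros)
    then show "((F \<circ> real_of_ereal) \<longlongrightarrow> F a) (at_right (ereal a))"
      unfolding ereal_tendsto_simps1 isCont_def by (rule tendsto_within_subset) simp
    show "((F \<circ> real_of_ereal) \<longlongrightarrow> B) (at_left \<infinity>)"
      unfolding ereal_tendsto_simps1 by (rule B)
  qed simp
  moreover have "einterval (ereal a) \<infinity> = {a<..}" by (auto simp: einterval_def)
  ultimately show ?thesis by simp
qed

lemma borel_measurable_strict_cm:
  assumes "strict_cm sinh (Suc k) f"
  shows "(\<lambda>r. indicat_real {0<..} r * f r) \<in> borel_measurable borel"
proof -
  have "continuous_on {0<..} f"
    using strict_cm_isCont[OF assms] by (intro continuous_at_imp_continuous_on) auto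
  then have "(\<lambda>r. indicat_real {0<..} r *\<^sub>R f r) \<in> borel_measurable borel"
    by (intro borel_measurable_continuous_on_indicator) auto
  then show ?thesis by simp
qed

text \<open>Near \<open>\<rho>\<close> the factor \<open>neg_deriv_sinh f\<close> is bounded by monotonicity; far from \<open>\<rho>\<close> the
  square root is bounded below and \<open>sinh r * neg_deriv_sinh f r\<close> is the derivative of \<open>- f\<close>.\<close>

lemma set_integrable_abel:
  assumes f: "strict_cm sinh (Suc (Suc k)) f" and \<rho>: "\<rho> > 0"
  shows "set_integrable lborel {\<rho><..} (\<lambda>r. sinh r / sqrt (cosh r - cosh \<rho>) * neg_deriv_sinh f r)"
proof -
  note g = neg_deriv_sinh_strict_cm[OF f]
  let ?h = "\<lambda>r. sinh r / sqrt (cosh r - cosh \<rho>) * neg_deriv_sinh f r"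
  have meas: "set_borel_measurable lborel A ?h" if "A \<subseteq> {\<rho><..}" "A \<in> sets borel" for A
  proof -
    have [measurable]: "A \<in> sets borel" "(\<lambda>r. indicat_real {0<..} r * neg_deriv_sinh f r) \<in> borel_measurable borel"
      by (fact that(2), rule borel_measurable_strict_cm[OF g(1)])
    have "(\<lambda>r. indicat_real A r * (sinh r / sqrt (cosh r - cosh \<rho>)) * (indicat_real {0<..} r * neg_deriv_sinh f r))
      \<in> borel_measurable borel"
      by measurable
    also have "(\<lambda>r. indicat_real A r * (sinh r / sqrt (cosh r - cosh \<rho>)) * (indicat_real {0<..} r * neg_deriv_sinh f r))
      = (\<lambda>r. indicat_real A r *\<^sub>R ?h r)"
      using that(1) \<rho> by (intro ext) (auto simp: indicator_def)
    finally show ?thesis by (simp add: set_borel_measurable_def)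
  qed
  have "set_integrable lborel {\<rho><..<\<rho>+1} ?h"
  proof (rule set_integrable_bound[OF set_integrable_mult_right[OF set_integrable_abel_near[OF \<rho>]]])
    show "set_borel_measurable lborel {\<rho><..<\<rho>+1} ?h" by (rule meas) auto
    show "AE r in lborel. r \<in> {\<rho><..<\<rho>+1} \<longrightarrow>
      norm (?h r) \<le> norm (neg_deriv_sinh f \<rho> * (sinh r / sqrt (cosh r - cosh \<rho>)))"
    proof (intro AE_I2 impI)
      fix r assume r: "r \<in> {\<rho><..<\<rho>+1}"
      then have "\<bar>neg_deriv_sinh f r\<bar> \<le> \<bar>neg_deriv_sinh f \<rho>\<bar>"
        using strict_cm_antimono[OF g(1), of \<rho> r] strict_cm_pos[OF g(1), of r] \<rho> by simp
      then show "norm (?h r) \<le> norm (neg_deriv_sinh f \<rho> * (sinh r / sqrt (cosh r - cosh \<rho>)))"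
        unfolding real_norm_def abs_mult
        by (subst mult.commute) (intro mult_right_mono, auto)
    qed
  qed
  moreover have "set_integrable lborel {\<rho>+1..} ?h"
  proof -
    define K where "K = 1 / sqrt (cosh (\<rho>+1) - cosh \<rho>)"
    have pos: "cosh (\<rho>+1) - cosh \<rho> > 0" using cosh_real_nonneg_less_iff[of \<rho> "\<rho>+1"] \<rho> by auto
    have "set_integrable lborel {\<rho><..} (\<lambda>r. sinh r * neg_deriv_sinh f r)"
      by (rule set_integrable_sinh_neg_deriv_sinh[OF f \<rho>])
    then have *: "set_integrable lborel {\<rho>+1..} (\<lambda>r. sinh r * neg_deriv_sinh f r)"
      by (rule set_integrable_subset) auto
    show ?thesis
    proof (rule set_integrable_bound[OF set_integrable_mult_right[OF *]])
      show "set_borel_measurable lborel {\<rho>+1..} ?h" by (rule meas) auto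
      show "AE r in lborel. r \<in> {\<rho>+1..} \<longrightarrow> norm (?h r) \<le> norm (K * (sinh r * neg_deriv_sinh f r))"
      proof (intro AE_I2 impI)
        fix r assume r: "r \<in> {\<rho>+1..}"
        have "cosh (\<rho>+1) \<le> cosh r"
          using r \<rho> by (subst cosh_real_nonneg_le_iff) auto
        then have "1 / sqrt (cosh r - cosh \<rho>) \<le> K"
          unfolding K_def using pos by (intro divide_left_mono) auto
        then have "1 / sqrt (cosh r - cosh \<rho>) * (sinh r * neg_deriv_sinh f r) \<le> K * (sinh r * neg_deriv_sinh f r)"
          using r \<rho> strict_cm_pos[OF g(1), of r] by (intro mult_right_mono) auto
        moreover have "?h r \<ge> 0"
          using r \<rho> strict_cm_pos[OF g(1), of r] \<open>cosh (\<rho>+1) \<le> cosh r\<close> pos by simp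
        ultimately show "norm (?h r) \<le> norm (K * (sinh r * neg_deriv_sinh f r))"
          by simp
      qed
    qed
  qed
  ultimately have "set_integrable lborel ({\<rho><..<\<rho>+1} \<union> {\<rho>+1..}) ?h"
    by (rule set_integrable_Un) auto
  moreover have "{\<rho><..<\<rho>+1} \<union> {\<rho>+1..} = {\<rho><..}" by auto
  ultimately show ?thesis by simp
qed

text \<open>In odd dimensions the kernel is itself an iterate of \<open>neg_deriv_sinh\<close> on
  the profile. In even dimensions it is an integral of a function positive on all of
  \<open>r > \<rho>\<close>.\<close>

lemma hyp_kernel_pos:
  assumes n: "n \<ge> 2" and s: "s > 0" and \<rho>: "\<rho> > 0"
  shows "hyp_kernel n s \<rho> > 0"
proof (cases "odd n")
  case True
  then show ?thesis
    using strict_cm_pos[OF funpow_neg_deriv_sinh_strict_cm[OF strict_cm_bessel_profile[OF n s]] \<rho>]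
    by (simp add: hyp_kernel_def)
next
  case False
  with n obtain m where m: "n div 2 = Suc m" by (cases "n div 2") auto
  define f where "f = (neg_deriv_sinh ^^ m) (bessel_profile n s)"
  have f: "strict_cm sinh k f" for k
    unfolding f_def by (rule funpow_neg_deriv_sinh_strict_cm[OF strict_cm_bessel_profile[OF n s]])
  note g = neg_deriv_sinh_strict_cm(1)[OF f]
  let ?h = "\<lambda>r. indicat_real {\<rho><..} r *\<^sub>R (sinh r / sqrt (cosh r - cosh \<rho>) * neg_deriv_sinh f r)"
  \<comment> \<open>Integrability is essential here: a divergent Bochner integral has the value 0,
    not a positive one.\<close>
  have int: "integrable lborel ?h"
    using set_integrable_abel[OF f \<rho>] unfolding set_integrable_def .
  have pos: "sinh r / sqrt (cosh r - cosh \<rho>) * neg_deriv_sinh f r > 0" if "r > \<rho>" for r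
    using that \<rho> cosh_real_nonneg_less_iff[of \<rho> r] strict_cm_pos[OF g, of r]
    by (intro mult_pos_pos divide_pos_pos) auto
  have hpos: "?h r > 0" if "r > \<rho>" for r
    using pos[OF that] that by (simp only: indicator_simps greaterThan_iff scaleR_one)
  have nn: "?h r \<ge> 0" for r
    by (cases "r > \<rho>") (use hpos[of r] in \<open>simp_all only: less_imp_le, simp\<close>)
  have "integral\<^sup>L lborel ?h \<noteq> 0"
  proof
    assume "integral\<^sup>L lborel ?h = 0"
    then have "AE r in lborel. ?h r = 0"
      using integral_nonneg_eq_0_iff_AE[OF int] nn by auto
    then have "AE r in lborel. r \<notin> {\<rho><..<\<rho>+1}"
    proof eventually_elim
      case (elim r)
      show ?case
      proof
        assume "r \<in> {\<rho><..<\<rho>+1}"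
        then have "r > \<rho>" by simp
        from hpos[OF this] have "0 < ?h r" .
        then show False unfolding elim by simp
      qed
    qed
    with not_AE_notin_Ioo[of \<rho> "\<rho> + 1"] show False by simp
  qed
  moreover have "integral\<^sup>L lborel ?h \<ge> 0"
    using nn by (rule Bochner_Integration.integral_nonneg)
  ultimately show ?thesis
    using False m by (simp add: hyp_kernel_def set_lebesgue_integral_def f_def)
qed

text \<open>In even dimensions the kernel is a parameter integral, measurable in
  \<open>\<rho>\<close> because the integrand is jointly measurable in \<open>\<rho>\<close> and
  \<open>r\<close>.\<close>

lemma borel_measurable_hyp_kernel:
  assumes n: "n \<ge> 2" and s: "s > 0"
  shows "(\<lambda>\<rho>. indicat_real {0<..} \<rho> * hyp_kernel n s \<rho>) \<in> borel_measurable borel"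
proof -
  define g where "g = (\<lambda>m. (neg_deriv_sinh ^^ m) (bessel_profile n s))"
  have g: "(\<lambda>r. indicat_real {0<..} r * g m r) \<in> borel_measurable borel" for m
    unfolding g_def
    by (rule borel_measurable_strict_cm[OF funpow_neg_deriv_sinh_strict_cm[OF strict_cm_bessel_profile[OF n s]]])
  show ?thesis
  proof (cases "odd n")
    case True
    then show ?thesis using g[of "(n - 1) div 2"] by (simp add: hyp_kernel_def g_def)
  next
    case False
    define G where "G = (\<lambda>r. indicat_real {0<..} r * g (n div 2) r)"
    have [measurable]: "G \<in> borel_measurable borel" unfolding G_def by (rule g)
    \<comment> \<open>The varying domain \<open>r > \<rho>\<close> and the restriction
      \<open>\<rho> > 0\<close> are put into the indicator of one Borel set of the plane.\<close>
    let ?H = "\<lambda>\<rho> r. indicat_real {x. snd x > fst x \<and> fst x > 0} (\<rho>, r) * (sinh r / sqrt (cosh r - cosh \<rho>)) * G r"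
    have "(\<lambda>\<rho>. \<integral>r. ?H \<rho> r \<partial>lborel) \<in> borel_measurable borel"
      by measurable
    also have "(\<lambda>\<rho>. \<integral>r. ?H \<rho> r \<partial>lborel) = (\<lambda>\<rho>. indicat_real {0<..} \<rho> * hyp_kernel n s \<rho>)"
    proof
      fix \<rho> :: real
      have "(\<integral>r. ?H \<rho> r \<partial>lborel) = (\<integral>r. indicat_real {0<..} \<rho> *
        (indicat_real {\<rho><..} r *\<^sub>R (sinh r / sqrt (cosh r - cosh \<rho>) * g (n div 2) r)) \<partial>lborel)"
        by (intro Bochner_Integration.integral_cong) (auto simp: indicator_def G_def)
      then show "(\<integral>r. ?H \<rho> r \<partial>lborel) = indicat_real {0<..} \<rho> * hyp_kernel n s \<rho>"
        unfolding integral_mult_right_zero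
        using False by (simp only: hyp_kernel_def set_lebesgue_integral_def g_def if_False)
    qed
    finally show ?thesis .
  qed
qed

section \<open>Hyperbolic space\<close>

lemma hyp_dist_arg_ge_1:
  assumes "x \<in> hyp_space" "y \<in> hyp_space"
  shows "1 \<le> 1 + 2 * (norm (x - y))\<^sup>2 / ((1 - (norm x)\<^sup>2) * (1 - (norm y)\<^sup>2))"
proof -
  have "(norm x)\<^sup>2 \<le> 1" "(norm y)\<^sup>2 \<le> 1"
    using assms by (simp_all add: hyp_space_def power_le_one)
  then show ?thesis by simp
qed

lemma hyp_dist_pos:
  assumes "x \<in> hyp_space" "y \<in> hyp_space" "x \<noteq> y"
  shows "hyp_dist x y > 0"
proof -
  have "(norm x)\<^sup>2 < 1" "(norm y)\<^sup>2 < 1"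
    using assms by (simp_all add: hyp_space_def abs_square_less_1)
  then show ?thesis using assms by (simp add: hyp_dist_def)
qed

lemma continuous_on_hyp_dist:
  assumes "x \<in> hyp_space"
  shows "continuous_on hyp_space (hyp_dist x)"
proof -
  have nz: "(1 - (norm x)\<^sup>2) * (1 - (norm y)\<^sup>2) \<noteq> 0" if "y \<in> hyp_space" for y
  proof -
    have "(norm x)\<^sup>2 < 1" "(norm y)\<^sup>2 < 1"
      using assms that by (simp_all add: hyp_space_def abs_square_less_1)
    then show ?thesis by simp
  qed
  have "continuous_on hyp_space
    (\<lambda>y. 1 + 2 * (norm (x - y))\<^sup>2 / ((1 - (norm x)\<^sup>2) * (1 - (norm y)\<^sup>2)))"
    using nz by (intro continuous_intros) auto
  then show ?thesis
    unfolding hyp_dist_def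
    by (rule continuous_on_compose2[OF continuous_on_arcosh[OF subset_refl]])
      (use hyp_dist_arg_ge_1[OF assms] in auto)
qed

section \<open>Null sets of the volume measure, and bounded sets in the ball model\<close>

lemma space_hyp_volume [simp]: "space hyp_volume = hyp_space"
  by (simp add: hyp_volume_def space_restrict_space)

lemma hyp_space_measurable [simp]: "hyp_space \<in> sets lebesgue"
  by (simp add: hyp_space_def)

lemma continuous_on_imp_borel_measurable_hyp_volume:
  fixes f :: "'a::euclidean_space \<Rightarrow> real"
  assumes "continuous_on hyp_space f"
  shows "f \<in> borel_measurable hyp_volume"
  using continuous_imp_measurable_on_sets_lebesgue[OF assms]
  by (simp add: hyp_volume_def measurable_density_eq1)

text \<open>The density is strictly positive on the ball, so the volume has the same null sets as
  Lebesgue measure there.\<close>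

lemma AE_hyp_volume_iff:
  "(AE x in hyp_volume. P x) \<longleftrightarrow> (AE x in lebesgue. x \<in> hyp_space \<longrightarrow> P x)" for P :: "'a::euclidean_space \<Rightarrow> bool"
proof -
  have "continuous_on hyp_space (\<lambda>x::'a. (2 / (1 - (norm x)\<^sup>2)) ^ DIM('a))"
  proof (intro continuous_intros ballI)
    show "1 - (norm x)\<^sup>2 \<noteq> 0" if "x \<in> hyp_space" for x :: 'a
      using that abs_square_less_1[of "norm x"] by (simp add: hyp_space_def)
  qed
  then have dens: "(\<lambda>x::'a. (2 / (1 - (norm x)\<^sup>2)) ^ DIM('a)) \<in> borel_measurable (lebesgue_on hyp_space)"
    by (rule continuous_imp_measurable_on_sets_lebesgue) (rule hyp_space_measurable)
  have "(AE x in hyp_volume. P x) \<longleftrightarrow>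
    (AE x in lebesgue_on hyp_space. 0 < ennreal ((2 / (1 - (norm x)\<^sup>2)) ^ DIM('a)) \<longrightarrow> P x)"
    unfolding hyp_volume_def by (rule AE_density[OF measurable_compose[OF dens measurable_ennreal]])
  also have "\<dots> \<longleftrightarrow> (AE x in lebesgue. x \<in> hyp_space \<longrightarrow>
      0 < ennreal ((2 / (1 - (norm x)\<^sup>2)) ^ DIM('a)) \<longrightarrow> P x)"
    by (rule AE_restrict_space_iff) simp
  also have "\<dots> \<longleftrightarrow> (AE x in lebesgue. x \<in> hyp_space \<longrightarrow> P x)"
  proof -
    have "0 < ennreal ((2 / (1 - (norm x)\<^sup>2)) ^ DIM('a))" if "x \<in> hyp_space" for x :: 'a
      using that abs_square_less_1[of "norm x"] by (simp add: hyp_space_def)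
    then have "(x \<in> hyp_space \<longrightarrow> 0 < ennreal ((2 / (1 - (norm x)\<^sup>2)) ^ DIM('a)) \<longrightarrow> P x) \<longleftrightarrow>
      (x \<in> hyp_space \<longrightarrow> P x)" for x by blast
    then show ?thesis by simp
  qed
  finally show ?thesis .
qed

text \<open>With \<open>y\<close> in \<open>S\<close> fixed, the distance bound becomes the closed
  condition \<open>2 * (norm (x - y))\<^sup>2 \<le> c * (1 - (norm x)\<^sup>2)\<close>, which passes
  to the closure. On the unit sphere it forces \<open>x = y\<close>, yet \<open>y\<close> is an
  interior point of the ball.\<close>

lemma hyp_bounded_closure_subset:
  fixes S :: "'a::euclidean_space set"
  assumes "S \<subseteq> hyp_space" "hyp_bounded S" "S \<noteq> {}"
  shows "closure S \<subseteq> hyp_space"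
proof -
  obtain R where R: "\<And>x y. x \<in> S \<Longrightarrow> y \<in> S \<Longrightarrow> hyp_dist x y \<le> R"
    using assms by (auto simp: hyp_bounded_def)
  obtain y where y: "y \<in> S" using assms by auto
  then have yH: "y \<in> hyp_space" using assms by auto
  have y1: "(norm y)\<^sup>2 < 1" using yH by (simp add: hyp_space_def abs_square_less_1)
  define c where "c = cosh R * (1 - (norm y)\<^sup>2)"
  have "2 * (norm (x - y))\<^sup>2 \<le> c * (1 - (norm x)\<^sup>2)" if x: "x \<in> S" for x
  proof -
    have xH: "x \<in> hyp_space" using x assms by auto
    then have x1: "(norm x)\<^sup>2 < 1" by (simp add: hyp_space_def abs_square_less_1)
    let ?t = "1 + 2 * (norm (x - y))\<^sup>2 / ((1 - (norm x)\<^sup>2) * (1 - (norm y)\<^sup>2))"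
    have t: "?t \<ge> 1" by (rule hyp_dist_arg_ge_1[OF xH yH])
    have "?t = cosh (hyp_dist x y)" using t by (simp add: hyp_dist_def)
    also have "\<dots> \<le> cosh R"
    proof -
      have "0 \<le> hyp_dist x y" using t by (simp add: hyp_dist_def)
      then show ?thesis using R[OF x y] cosh_real_nonneg_le_iff[of "hyp_dist x y" R] by simp
    qed
    finally have "2 * (norm (x - y))\<^sup>2 / ((1 - (norm x)\<^sup>2) * (1 - (norm y)\<^sup>2)) \<le> cosh R" by simp
    then show ?thesis using x1 y1 by (simp add: c_def pos_divide_le_eq mult_ac)
  qed
  then have "S \<subseteq> {x. 2 * (norm (x - y))\<^sup>2 \<le> c * (1 - (norm x)\<^sup>2)}" by auto
  moreover have "closed {x. 2 * (norm (x - y))\<^sup>2 \<le> c * (1 - (norm x)\<^sup>2)}"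
    by (intro closed_Collect_le continuous_intros)
  ultimately have 1: "closure S \<subseteq> {x. 2 * (norm (x - y))\<^sup>2 \<le> c * (1 - (norm x)\<^sup>2)}"
    by (rule closure_minimal)
  have 2: "closure S \<subseteq> cball 0 1"
    using assms(1) by (intro closure_minimal) (auto simp: hyp_space_def)
  show ?thesis
  proof
    fix x assume x: "x \<in> closure S"
    show "x \<in> hyp_space"
    proof (rule ccontr)
      assume "x \<notin> hyp_space"
      then have "norm x = 1" using 2 x by (auto simp: hyp_space_def)
      then have "x = y" using 1 x by auto
      then show False using yH \<open>x \<notin> hyp_space\<close> by simp
    qed
  qed
qed

text \<open>Otherwise the open set \<open>hyp_space - K\<close> would be negligible, hence empty,
  and the open ball would be compact.\<close>

lemma not_AE_in_compact_subset_hyp_space: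
  fixes K :: "'a::euclidean_space set"
  assumes "compact K" "K \<subseteq> hyp_space"
  shows "\<not> (AE x in hyp_volume. x \<in> K)"
proof
  assume "AE x in hyp_volume. x \<in> K"
  then have "AE x in lebesgue. x \<notin> hyp_space - K"
    unfolding AE_hyp_volume_iff by eventually_elim auto
  moreover have op: "open (hyp_space - K)"
    unfolding hyp_space_def using assms(1) by (intro open_Diff compact_imp_closed) auto
  ultimately have "negligible (hyp_space - K)"
    using AE_iff_null_sets[of "hyp_space - K" lebesgue] by (simp add: negligible_iff_null_sets)
  with op have "hyp_space = K"
    using assms(2) open_not_negligible by blast
  then have "compact (ball (0::'a) 1)" using assms(1) by (simp add: hyp_space_def)
  then show False using compact_imp_closed[of "ball (0::'a) 1"] clopen[of "ball (0::'a) 1"]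
    by (metis UNIV_I bounded_ball not_bounded_UNIV centre_in_ball empty_iff open_ball zero_less_one)
qed

section \<open>The fractional Laplacian at a minimum\<close>

text \<open>Without a minimum the relatively open sets where \<open>u > u y\<close>, for
  \<open>y\<close> in \<open>S\<close>, cover \<open>S\<close>. Among the finitely many
  \<open>y\<close> of a subcover, one with least value lies in none of its sets.\<close>

lemma lsc_on_compact_attains_inf:
  fixes S :: "'a::t2_space set" and u :: "'a \<Rightarrow> real"
  assumes "compact S" "S \<noteq> {}" "lsc_on S u"
  shows "\<exists>x\<in>S. \<forall>y\<in>S. u x \<le> u y"
proof (rule ccontr)
  assume "\<not> ?thesis"
  then have no_min: "\<And>x. x \<in> S \<Longrightarrow> \<exists>y\<in>S. u y < u x" by (auto simp: not_le)
  have "\<exists>T. open T \<and> S \<inter> T = {x\<in>S. u y < u x}" for y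
  proof -
    have "openin (top_of_set S) {x\<in>S. u y < u x}"
    proof (subst openin_subopen, intro ballI)
      fix x assume x: "x \<in> {x\<in>S. u y < u x}"
      then have "\<forall>\<^sub>F z in at x within S. u y < u z"
        using assms(3) by (auto simp: lsc_on_def)
      then obtain T where T: "open T" "x \<in> T" "\<And>z. z \<in> T \<Longrightarrow> z \<noteq> x \<Longrightarrow> z \<in> S \<Longrightarrow> u y < u z"
        unfolding eventually_at_topological by auto
      then show "\<exists>T. openin (top_of_set S) T \<and> x \<in> T \<and> T \<subseteq> {x\<in>S. u y < u x}"
        using x by (intro exI[of _ "S \<inter> T"]) auto
    qed
    then show ?thesis unfolding openin_open by auto
  qed
  then obtain T where T: "\<And>y. open (T y)" "\<And>y. S \<inter> T y = {x\<in>S. u y < u x}" by metis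
  have "S \<subseteq> (\<Union>y\<in>S. T y)" using no_min T(2) by blast
  with assms(1) obtain F where F: "F \<subseteq> S" "finite F" "S \<subseteq> (\<Union>y\<in>F. T y)"
    using T(1) by (metis compactE_image)
  then have "F \<noteq> {}" using assms(2) by auto
  define m where "m = arg_min_on u F"
  have m: "m \<in> F" "\<And>y. y \<in> F \<Longrightarrow> u m \<le> u y"
    unfolding m_def using \<open>finite F\<close> \<open>F \<noteq> {}\<close> by (auto intro: arg_min_if_finite arg_min_least)
  then obtain y where "y \<in> F" "m \<in> T y" using F by blast
  then have "u y < u m" using T(2)[of y] m F by auto
  with m(2)[OF \<open>y \<in> F\<close>] show False by simp
qed

text \<open>Identifies the principal value of a monotone family with an infimum, so that a lower
  bound on the limit is one on every truncated integral.\<close>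

lemma tendsto_at_right_INF:
  fixes G :: "real \<Rightarrow> 'b::{complete_linorder,linorder_topology}"
  assumes mono: "\<And>a b. 0 < a \<Longrightarrow> a \<le> b \<Longrightarrow> G a \<le> G b"
  shows "(G \<longlongrightarrow> (INF \<epsilon>\<in>{0<..}. G \<epsilon>)) (at_right 0)"
proof (rule decreasing_tendsto)
  show "\<forall>\<^sub>F \<epsilon> in at_right 0. (INF \<epsilon>\<in>{0<..}. G \<epsilon>) \<le> G \<epsilon>"
    by (auto simp: eventually_at_filter intro!: INF_lower always_eventually)
  fix y assume "(INF \<epsilon>\<in>{0<..}. G \<epsilon>) < y"
  then obtain b where b: "b > 0" "G b < y" by (auto simp: INF_less_iff)
  show "\<forall>\<^sub>F \<epsilon> in at_right 0. G \<epsilon> < y"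
    using eventually_at_right_real[OF b(1)]
  proof eventually_elim
    case (elim \<epsilon>)
    then show ?case using le_less_trans[OF mono b(2), of \<epsilon>] by simp
  qed
qed

lemma AE_eq_minimum_if_frac_laplacian_nonneg:
  fixes u :: "'a::euclidean_space \<Rightarrow> real"
  assumes n: "DIM('a) \<ge> 2" and "s > 0" "C > 0"
    and u: "u \<in> borel_measurable hyp_volume"
    and x: "x \<in> hyp_space" and min: "\<And>\<xi>. \<xi> \<in> hyp_space \<Longrightarrow> u x \<le> u \<xi>"
    and lap: "hyp_frac_laplacian C s u x \<ge> 0"
  shows "AE \<xi> in hyp_volume. u \<xi> = u x"
proof -
  let ?K = "\<lambda>\<xi>. hyp_kernel DIM('a) s (hyp_dist x \<xi>)"
  define I where "I = (\<lambda>\<epsilon> \<xi>. indicat_real {\<xi>. \<epsilon> \<le> hyp_dist x \<xi>} \<xi> * ((u x - u \<xi>) * ?K \<xi>))"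
  have K: "?K \<xi> > 0" if "hyp_dist x \<xi> > 0" for \<xi>
    using hyp_kernel_pos[OF n \<open>s > 0\<close> that] .
  have I_nonpos: "I \<epsilon> \<xi> \<le> 0" if "\<epsilon> > 0" "\<xi> \<in> hyp_space" for \<epsilon> \<xi>
    using K[of \<xi>] min[OF that(2)] that(1) by (auto simp: I_def indicator_def intro!: mult_nonpos_nonneg)
  have I_mono: "I a \<xi> \<le> I b \<xi>" if "0 < a" "a \<le> b" "\<xi> \<in> hyp_space" for a b \<xi>
    using I_nonpos[OF that(1,3)] that by (auto simp: I_def indicator_def)
  have I_meas: "I \<epsilon> \<in> borel_measurable hyp_volume" if "\<epsilon> > 0" for \<epsilon>
  proof -
    \<comment> \<open>Measurability of the kernel is available on positive arguments only; cutting
      it off there does not change \<open>I \<epsilon>\<close>, which vanishes at distances below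
      \<open>\<epsilon>\<close>.\<close>
    define k where "k = (\<lambda>\<rho>. indicat_real {0<..} \<rho> * hyp_kernel DIM('a) s \<rho>)"
    have [measurable]: "k \<in> borel_measurable borel"
      unfolding k_def by (rule borel_measurable_hyp_kernel[OF n \<open>s > 0\<close>])
    have [measurable]: "hyp_dist x \<in> borel_measurable hyp_volume"
      by (rule continuous_on_imp_borel_measurable_hyp_volume[OF continuous_on_hyp_dist[OF x]])
    note [measurable] = u
    have "(\<lambda>\<xi>. indicat_real {\<epsilon>..} (hyp_dist x \<xi>) * ((u x - u \<xi>) * k (hyp_dist x \<xi>))) \<in> borel_measurable hyp_volume"
      by measurable
    also have "(\<lambda>\<xi>. indicat_real {\<epsilon>..} (hyp_dist x \<xi>) * ((u x - u \<xi>) * k (hyp_dist x \<xi>))) = I \<epsilon>"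
      using that by (auto simp: I_def k_def indicator_def)
    finally show ?thesis .
  qed
  define G where "G = (\<lambda>\<epsilon>. hyp_integral (I \<epsilon>))"
  have G: "G \<epsilon> = - enn2ereal (\<integral>\<^sup>+ \<xi>. ennreal (- I \<epsilon> \<xi>) \<partial>hyp_volume)" if "\<epsilon> > 0" for \<epsilon>
  proof -
    \<comment> \<open>The positive part contributes nothing, so the difference defining
      \<open>hyp_integral\<close> is never of the form
      \<open>\<infinity> - \<infinity>\<close>.\<close>
    have "(\<integral>\<^sup>+ \<xi>. ennreal (I \<epsilon> \<xi>) \<partial>hyp_volume) = (\<integral>\<^sup>+ \<xi>. 0 \<partial>(hyp_volume :: 'a measure))"
      using I_nonpos[OF that] by (intro nn_integral_cong) (simp add: ennreal_neg)
    then show ?thesis by (simp add: G_def hyp_integral_def zero_ennreal.rep_eq)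
  qed
  have "G a \<le> G b" if "0 < a" "a \<le> b" for a b
  proof -
    have "(\<integral>\<^sup>+ \<xi>. ennreal (- I b \<xi>) \<partial>hyp_volume) \<le> (\<integral>\<^sup>+ \<xi>. ennreal (- I a \<xi>) \<partial>hyp_volume)"
      using I_mono[OF that] by (intro nn_integral_mono ennreal_leI) simp
    then show ?thesis using that by (simp add: G less_eq_ennreal.rep_eq)
  qed
  then have "(G \<longlongrightarrow> (INF \<epsilon>\<in>{0<..}. G \<epsilon>)) (at_right 0)"
    by (rule tendsto_at_right_INF)
  then have "Lim (at_right 0) G = (INF \<epsilon>\<in>{0<..}. G \<epsilon>)"
    by (intro tendsto_Lim) simp_all
  moreover have "Lim (at_right 0) G \<ge> 0"
    using lap \<open>C > 0\<close> by (simp add: hyp_frac_laplacian_def G_def I_def ereal_zero_le_0_iff)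
  ultimately have G_nonneg: "G \<epsilon> \<ge> 0" if "\<epsilon> > 0" for \<epsilon>
    using that by (auto simp: le_INF_iff)
  \<comment> \<open>Countably many radii suffice: the complements of the balls of radius
    \<open>1 / (m + 1)\<close> exhaust all points other than \<open>x\<close>.\<close>
  have "AE \<xi> in hyp_volume. \<forall>m. inverse (real (Suc m)) \<le> hyp_dist x \<xi> \<longrightarrow> u \<xi> = u x"
    unfolding AE_all_countable
  proof
    fix m
    define \<epsilon> where "\<epsilon> = inverse (real (Suc m))"
    have \<epsilon>: "\<epsilon> > 0" by (simp add: \<epsilon>_def)
    have "enn2ereal (\<integral>\<^sup>+ \<xi>. ennreal (- I \<epsilon> \<xi>) \<partial>hyp_volume) \<le> 0"
      using G_nonneg[OF \<epsilon>] G[OF \<epsilon>] by simp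
    then have "(\<integral>\<^sup>+ \<xi>. ennreal (- I \<epsilon> \<xi>) \<partial>hyp_volume) = 0"
      by (metis enn2ereal_nonneg antisym enn2ereal_inject zero_ennreal.rep_eq)
    then have "AE \<xi> in hyp_volume. ennreal (- I \<epsilon> \<xi>) = 0"
      using I_meas[OF \<epsilon>] by (subst (asm) nn_integral_0_iff_AE) auto
    then show "AE \<xi> in hyp_volume. inverse (real (Suc m)) \<le> hyp_dist x \<xi> \<longrightarrow> u \<xi> = u x"
      unfolding \<epsilon>_def[symmetric] using AE_space
    proof eventually_elim
      case (elim \<xi>)
      show ?case
      proof
        assume d: "\<epsilon> \<le> hyp_dist x \<xi>"
        then have "I \<epsilon> \<xi> = (u x - u \<xi>) * ?K \<xi>" by (simp add: I_def)
        moreover have "I \<epsilon> \<xi> = 0"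
          using elim I_nonpos[OF \<epsilon>, of \<xi>] by (simp add: ennreal_eq_0_iff)
        ultimately show "u \<xi> = u x" using K[of \<xi>] d \<epsilon> by simp
      qed
    qed
  qed
  then show ?thesis
    using AE_space
  proof eventually_elim
    case (elim \<xi>)
    show ?case
    proof (cases "\<xi> = x")
      case False
      then have "hyp_dist x \<xi> > 0" using elim x by (intro hyp_dist_pos) auto
      then obtain m where "inverse (real (Suc m)) < hyp_dist x \<xi>" using reals_Archimedean by blast
      then show ?thesis using elim(1) less_imp_le by blast
    qed simp
  qed
qed

theorem theorem5p1:
  fixes \<Omega> :: "'a::euclidean_space set" and u :: "'a \<Rightarrow> real" and p :: 'a and s C :: real
  assumes "DIM('a) \<ge> 2" and "0 < s" and "s < 1" and "C > 0"
    and "p \<in> hyp_space"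
    and "hyp_bounded_domain \<Omega>"
    and "u \<in> hyp_L s p \<inter> C11_loc \<Omega>"
    and "lsc_on (hyp_closure \<Omega>) u"
    and "\<And>x. x \<in> \<Omega> \<Longrightarrow> hyp_frac_laplacian C s u x \<ge> 0"
    and "\<And>x. x \<in> hyp_space - \<Omega> \<Longrightarrow> u x \<ge> 0"
  shows "(\<forall>x\<in>\<Omega>. u x \<ge> 0) \<and>
    ((\<exists>x\<in>\<Omega>. u x = 0) \<longrightarrow> (AE x in hyp_volume. u x = 0))"
proof -
  have \<Omega>: "\<Omega> \<subseteq> hyp_space" "hyp_bounded \<Omega>" "\<Omega> \<noteq> {}"
    using assms(6) by (auto simp: hyp_bounded_domain_def)
  have u: "u \<in> borel_measurable hyp_volume" using assms(7) by (auto simp: hyp_L_def)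
  \<comment> \<open>Boundedness keeps \<open>\<Omega>\<close> away from the ideal boundary, so its
    closure in hyperbolic space is a compact Euclidean set.\<close>
  have cl: "closure \<Omega> \<subseteq> hyp_space" by (rule hyp_bounded_closure_subset[OF \<Omega>])
  then have cl_eq: "hyp_closure \<Omega> = closure \<Omega>" by (auto simp: hyp_closure_def)
  have comp: "compact (closure \<Omega>)"
    using bounded_subset[of "ball 0 1" \<Omega>] \<Omega>(1) by (simp add: hyp_space_def)
  have const: "AE \<xi> in hyp_volume. u \<xi> = u x"
    if "x \<in> \<Omega>" "\<And>\<xi>. \<xi> \<in> hyp_space \<Longrightarrow> u x \<le> u \<xi>" for x
    using that \<Omega>(1) assms(9)[OF that(1)]
    by (intro AE_eq_minimum_if_frac_laplacian_nonneg[OF assms(1,2,4) u]) auto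
  have nonneg: "u x \<ge> 0" if "x \<in> \<Omega>" for x
  proof (rule ccontr)
    assume "\<not> u x \<ge> 0"
    obtain x0 where x0: "x0 \<in> closure \<Omega>" "\<And>y. y \<in> closure \<Omega> \<Longrightarrow> u x0 \<le> u y"
      using lsc_on_compact_attains_inf[OF comp _ assms(8)[unfolded cl_eq]] \<Omega>(3) by auto
    have neg: "u x0 < 0"
      using x0(2)[of x] that closure_subset[of \<Omega>] \<open>\<not> u x \<ge> 0\<close> by fastforce
    \<comment> \<open>A negative value cannot occur outside \<open>\<Omega>\<close>. This excludes
      boundary points and, next, makes the minimum over the closure a global one.\<close>
    have "x0 \<in> \<Omega>" using assms(10)[of x0] neg x0(1) cl by force
    moreover have "u x0 \<le> u \<xi>" if "\<xi> \<in> hyp_space" for \<xi>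
      using assms(10)[of \<xi>] x0(2)[of \<xi>] neg that closure_subset[of \<Omega>] by fastforce
    ultimately have "AE \<xi> in hyp_volume. u \<xi> = u x0" by (rule const)
    \<comment> \<open>Where \<open>u\<close> equals the negative number \<open>u x0\<close>, the
      point lies in \<open>\<Omega>\<close>.\<close>
    then have "AE \<xi> in hyp_volume. \<xi> \<in> closure \<Omega>"
      using AE_space
    proof eventually_elim
      case (elim \<xi>)
      then show ?case using assms(10)[of \<xi>] neg closure_subset[of \<Omega>] by fastforce
    qed
    then show False using not_AE_in_compact_subset_hyp_space[OF comp cl] by contradiction
  qed
  \<comment> \<open>Since \<open>u \<ge> 0\<close> everywhere by now, a zero in
    \<open>\<Omega>\<close> is a global minimum.\<close>
  moreover have "AE \<xi> in hyp_volume. u \<xi> = 0" if "x \<in> \<Omega>" "u x = 0" for x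
    using const[OF that(1)] nonneg assms(10) that(2) by (metis DiffI)
  ultimately show ?thesis by blast
qed

end
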